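(* Let a mixed-integer program be given by $A\in\mathbb{R}^{m\times n}$, $b\in\mathbb{R}^m$, $c\in\mathbb{R}^n$ and $p\in\{0,\dots,n\}$, and let $H_{Reduced}$ be the Reduced QUBO objective associated with it. If $H_{Reduced}(\pi^*,\sigma^* )=0$ for some binary $(\pi^*,\sigma^* )$ (with the entries excluded from the reduced formulation fixed to zero), then $\pi^*$ is a formulation symmetry. Moreover, if $\bar\pi$ is a formulation symmetry, then there exists some corresponding $\bar\sigma$ such that $H_{Reduced}(\bar\pi,\bar\sigma)=0$.
   Context: The mixed-integer program (MIP) is $\max\{c^Tx : Ax\le b,\ x\in\mathbb{Z}^p\times\mathbb{R}^{n-p}\}$, with $n$ variables $x_1,\dots,x_n$ (the first $p$ integer) and $m$ constraints. Formulation symmetry: a variable permutation $\pi\in S_n$ such that there exists a corresponding constraint permutation $\sigma\in S_m$ with (i) $\pi(\{1,\dots,p\})=\{1,\dots,p\}$; (ii) $\pi(c)=c$, i.e. $c_{\pi(j)}=c_j$ for all $j$; (iii) $\sigma(b)=b$, i.e. $b_{\sigma(i)}=b_i$ for all $i$; (iv) $A_{\sigma(i),\pi(j)}=A_{ij}$ for all $i,j$. Matrix convention: a permutation $\pi\in S_n$ is identified with the matrix $\pi\in\{0,1\}^{n\times n}$ such that $\pi_{jj'}=1$ if and only if $\pi(j)=j'$ ($x_j$ is mapped to $x_{j'}$); similarly for $\sigma\in S_m$ and $\sigma\in\{0,1\}^{m\times m}$ ($\sigma_{ii'}=1$ iff constraint $i$ is mapped to constraint $i'$). A binary matrix is said to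 be a formulation symmetry if it is a permutation matrix whose permutation is a formulation symmetry. Reasonable index sets: for a variable index $j$, $r(j)$ is the set of all $j'\in\{1,\dots,n\}$ such that $x_j$ and $x_{j'}$ have the same domain (both integer or both continuous) and $c_j=c_{j'}$. For a constraint index $i$, $r(i)$ is the set of all $i'\in\{1,\dots,m\}$ with $b_i=b_{i'}$. Let $\Pi=\{\pi_{jj'}: j'\in r(j),\ j\in\{1,\dots,n\}\}$ and $\Sigma=\{\sigma_{ii'}: i'\in r(i),\ i\in\{1,\dots,m\}\}$. Reduced QUBO: the only decision variables are the binary entries in $\Pi$ and $\Sigma$; all other entries of $\pi\in\{0,1\}^{n\times n}$ and $\sigma\in\{0,1\}^{m\times m}$ are fixed to zero (so all sums below effectively run over retained entries only). The objective is $H_{Reduced}(\pi,\sigma)=H_{B,\pi}+H_{B,\sigma}+H_A$, where $$H_{B,\pi}=\sum_{j=1}^n\Big(\sum_{j'=1}^n\pi_{jj'}-1\Big)^2+\sum_{j'=1}^n\Big(\sum_{j=1}^n\pi_{jj'}-1\Big)^2,$$ $$H_{B,\sigma}=\sum_{i=1}^m\Big(\sum_{i'=1}^m\sigma_{ii'}-1\Big)^2+\sum_{i'=1}^m\Big(\sum_{i=1}^m\sigma_{ii'}-1\Big)^2,$$ $$H_A=\sum_{(i,j,i',j'):\,A_{ij}\ne A_{i'j'}}\sigma_{ii'}\pi_{jj'}.$$ *)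

theory Defs
  imports "Jordan_Normal_Form.Matrix" "HOL-Combinatorics.Permutations"
begin

text \<open>
  The mixed-integer program is max c x subject to A x \<open>\<le>\<close> b, given by \<open>A\<close>, \<open>b\<close>, \<open>c\<close> and \<open>p\<close>.
  Indices start at 0: the constraints are \<open>{..<dim_row A}\<close>, the variables are
  \<open>{..<dim_col A}\<close>, and the integer variables are \<open>{..<p}\<close>.
\<close>

definition corresponding_constraint_perm ::
  "real mat \<Rightarrow> real vec \<Rightarrow> (nat \<Rightarrow> nat) \<Rightarrow> (nat \<Rightarrow> nat) \<Rightarrow> bool" where
  "corresponding_constraint_perm A b \<pi> \<sigma> \<longleftrightarrow>
     \<sigma> permutes {..<dim_row A} \<and>
     (\<forall>i<dim_row A. b $ \<sigma> i = b $ i) \<and>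
     (\<forall>i<dim_row A. \<forall>j<dim_col A. A $$ (\<sigma> i, \<pi> j) = A $$ (i, j))"

definition formulation_symmetry ::
  "real mat \<Rightarrow> real vec \<Rightarrow> real vec \<Rightarrow> nat \<Rightarrow> (nat \<Rightarrow> nat) \<Rightarrow> bool" where
  "formulation_symmetry A b c p \<pi> \<longleftrightarrow>
     \<pi> permutes {..<dim_col A} \<and>
     \<pi> ` {..<p} = {..<p} \<and>
     (\<forall>j<dim_col A. c $ \<pi> j = c $ j) \<and>
     (\<exists>\<sigma>. corresponding_constraint_perm A b \<pi> \<sigma>)"

definition perm_mat :: "nat \<Rightarrow> (nat \<Rightarrow> nat) \<Rightarrow> real mat" where
  "perm_mat k \<rho> = mat k k (\<lambda>(i, i'). if \<rho> i = i' then 1 else 0)"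

definition formulation_symmetry_mat ::
  "real mat \<Rightarrow> real vec \<Rightarrow> real vec \<Rightarrow> nat \<Rightarrow> real mat \<Rightarrow> bool" where
  "formulation_symmetry_mat A b c p P \<longleftrightarrow>
     (\<exists>\<pi>. formulation_symmetry A b c p \<pi> \<and> P = perm_mat (dim_col A) \<pi>)"

definition binary_mat :: "nat \<Rightarrow> real mat \<Rightarrow> bool" where
  "binary_mat k M \<longleftrightarrow> M \<in> carrier_mat k k \<and> elements_mat M \<subseteq> {0, 1}"

definition reasonable_vars :: "nat \<Rightarrow> real vec \<Rightarrow> nat \<Rightarrow> nat set" where
  "reasonable_vars p c j = {j'. j' < dim_vec c \<and> (j < p \<longleftrightarrow> j' < p) \<and> c $ j = c $ j'}"

definition reasonable_cons :: "real vec \<Rightarrow> nat \<Rightarrow> nat set" where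
  "reasonable_cons b i = {i'. i' < dim_vec b \<and> b $ i = b $ i'}"

text \<open>
  A point of the reduced QUBO is represented by the two full binary matrices in which every
  entry that is not a decision variable is zero.
\<close>

definition reduced_assignment ::
  "real mat \<Rightarrow> real vec \<Rightarrow> real vec \<Rightarrow> nat \<Rightarrow> real mat \<Rightarrow> real mat \<Rightarrow> bool" where
  "reduced_assignment A b c p P S \<longleftrightarrow>
     binary_mat (dim_col A) P \<and> binary_mat (dim_row A) S \<and>
     (\<forall>j<dim_col A. \<forall>j'<dim_col A. j' \<notin> reasonable_vars p c j \<longrightarrow> P $$ (j, j') = 0) \<and>
     (\<forall>i<dim_row A. \<forall>i'<dim_row A. i' \<notin> reasonable_cons b i \<longrightarrow> S $$ (i, i') = 0)"

definition H_B :: "nat \<Rightarrow> real mat \<Rightarrow> real" where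
  "H_B k M = (\<Sum>i<k. ((\<Sum>i'<k. M $$ (i, i')) - 1)\<^sup>2) + (\<Sum>i'<k. ((\<Sum>i<k. M $$ (i, i')) - 1)\<^sup>2)"

definition H_A :: "real mat \<Rightarrow> real mat \<Rightarrow> real mat \<Rightarrow> real" where
  "H_A A P S =
     (\<Sum>(i, j, i', j') \<in> {(i, j, i', j').
          i < dim_row A \<and> j < dim_col A \<and> i' < dim_row A \<and> j' < dim_col A \<and>
          A $$ (i, j) \<noteq> A $$ (i', j')}.
        S $$ (i, i') * P $$ (j, j'))"

text \<open>
  The objective depends on \<open>b\<close>, \<open>c\<close> and \<open>p\<close> only through the set of points on which it is
  considered, see \<open>reduced_assignment\<close>.
\<close>

definition H_Reduced :: "real mat \<Rightarrow> real mat \<Rightarrow> real mat \<Rightarrow> real" where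
  "H_Reduced A P S = H_B (dim_col A) P + H_B (dim_row A) S + H_A A P S"

end

theory Submission
  imports Defs
begin

text \<open>
  All terms of the objective are nonnegative. The row and column penalties vanish exactly on
  permutation matrices, and on a pair of permutation matrices \<open>H_A\<close> counts the entries
  \<open>(i, j)\<close> of \<open>A\<close> with \<open>A\<^bsub>\<sigma> i, \<pi> j\<^esub> \<noteq> A\<^bsub>i, j\<^esub>\<close>; the fixed zero entries encode the conditions
  on \<open>b\<close>, \<open>c\<close> and \<open>p\<close>.
\<close>

lemma perm_mat_carrier [simp]: "perm_mat k \<rho> \<in> carrier_mat k k"
  by (simp add: perm_mat_def)

lemma index_perm_mat [simp]:
  "i < k \<Longrightarrow> i' < k \<Longrightarrow> perm_mat k \<rho> $$ (i, i') = (if \<rho> i = i' then 1 else 0)"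
  by (simp add: perm_mat_def)

lemma binary_mat_iff:
  "binary_mat k M \<longleftrightarrow>
     M \<in> carrier_mat k k \<and> (\<forall>i<k. \<forall>i'<k. M $$ (i, i') = 0 \<or> M $$ (i, i') = 1)"
  unfolding binary_mat_def by (fastforce simp: elements_mat_def)

lemma binary_perm_mat: "binary_mat k (perm_mat k \<rho>)"
  by (simp add: binary_mat_iff)

text \<open>A zero-one sum counts its ones, so the value 1 makes the set of ones a
  singleton.\<close>

lemma ex1_if_zero_one_sum_eq_1:
  fixes f :: "'a \<Rightarrow> real"
  assumes "finite I" and "\<And>i. i \<in> I \<Longrightarrow> f i = 0 \<or> f i = 1" and "sum f I = 1"
  shows "\<exists>!i. i \<in> I \<and> f i = 1"
proof -
  have "sum f I = (\<Sum>i\<in>I. if f i = 1 then 1 else 0)"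
    using assms(2) by (intro sum.cong) auto
  also have "\<dots> = real (card {i \<in> I. f i = 1})"
    using assms(1) by (simp add: sum.If_cases Int_def)
  finally have "card {i \<in> I. f i = 1} = 1"
    using assms(3) by simp
  then obtain i where "{i \<in> I. f i = 1} = {i}"
    by (auto simp: card_1_singleton_iff)
  then have "j \<in> I \<and> f j = 1 \<longleftrightarrow> j = i" for j
    by blast
  then show ?thesis
    by simp
qed

lemma H_B_nonneg: "H_B k M \<ge> 0"
  by (simp add: H_B_def sum_nonneg)

lemma H_B_eq_0_iff:
  "H_B k M = 0 \<longleftrightarrow>
     (\<forall>i<k. (\<Sum>i'<k. M $$ (i, i')) = 1) \<and> (\<forall>i'<k. (\<Sum>i<k. M $$ (i, i')) = 1)"
  by (auto simp: H_B_def add_nonneg_eq_0_iff sum_nonneg sum_nonneg_eq_0_iff)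

lemma H_B_perm_mat:
  assumes "\<rho> permutes {..<k}"
  shows "H_B k (perm_mat k \<rho>) = 0"
proof -
  have lt: "\<rho> i < k \<longleftrightarrow> i < k" for i
    using permutes_in_image[OF assms] by simp
  have "(\<Sum>i'<k. perm_mat k \<rho> $$ (i, i')) = 1" if "i < k" for i
    using that by (simp add: lt)
  moreover have "(\<Sum>i<k. perm_mat k \<rho> $$ (i, i')) = 1" if i': "i' < k" for i'
  proof -
    obtain j where j: "\<rho> j = i'"
      using permutes_surj[OF assms] by (metis surjD)
    \<comment> \<open>By injectivity the preimage \<open>j\<close> is the only row with a one in
      column \<open>i'\<close>.\<close>
    then have "(\<Sum>i<k. perm_mat k \<rho> $$ (i, i')) = (\<Sum>i<k. if i = j then 1 else 0)"
      using i' permutes_inj[OF assms] by (intro sum.cong) (auto dest: injD)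
    also have "\<dots> = 1"
      using i' j lt by auto
    finally show ?thesis .
  qed
  ultimately show ?thesis
    by (simp add: H_B_eq_0_iff)
qed

text \<open>The row sums make the positions of the ones a function, the column sums make it
  injective, and finiteness makes it bijective.\<close>

lemma binary_mat_H_B_eq_0D:
  assumes M: "binary_mat k M" and H: "H_B k M = 0"
  obtains \<rho> where "\<rho> permutes {..<k}" and "M = perm_mat k \<rho>"
proof -
  have row: "\<exists>!i'. i' \<in> {..<k} \<and> M $$ (i, i') = 1" if "i < k" for i
    using that M H by (intro ex1_if_zero_one_sum_eq_1) (auto simp: binary_mat_iff H_B_eq_0_iff)
  have col: "\<exists>!i. i \<in> {..<k} \<and> M $$ (i, i') = 1" if "i' < k" for i'
    using that M H by (intro ex1_if_zero_one_sum_eq_1) (auto simp: binary_mat_iff H_B_eq_0_iff)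
  \<comment> \<open>\<open>permutes\<close> demands the identity outside \<open>{..<k}\<close>,
    hence the default value \<open>i\<close>.\<close>
  define \<rho> where "\<rho> i = (if i < k then THE i'. i' \<in> {..<k} \<and> M $$ (i, i') = 1 else i)" for i
  have \<rho>: "\<rho> i < k \<and> M $$ (i, \<rho> i) = 1" if "i < k" for i
    using theI'[OF row[OF that]] that by (simp add: \<rho>_def)
  have "inj_on \<rho> {..<k}"
  proof (rule inj_onI)
    fix i j
    assume "i \<in> {..<k}" "j \<in> {..<k}" "\<rho> i = \<rho> j"
    \<comment> \<open>Rows \<open>i\<close> and \<open>j\<close> both have a one in column
      \<open>\<rho> i\<close>, which contains only one.\<close>
    then show "i = j"
      using \<rho>[of i] \<rho>[of j] col[of "\<rho> i"] by auto
  qed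
  moreover have "\<rho> ` {..<k} \<subseteq> {..<k}"
    using \<rho> by auto
  ultimately have "bij_betw \<rho> {..<k} {..<k}"
    by (simp add: bij_betw_def endo_inj_surj)
  then have "\<rho> permutes {..<k}"
    by (rule bij_imp_permutes) (simp add: \<rho>_def)
  moreover have "M $$ (i, i') = (if \<rho> i = i' then 1 else 0)" if "i < k" "i' < k" for i i'
    using that \<rho>[of i] row[of i] M by (auto simp: binary_mat_iff)
  then have "M = perm_mat k \<rho>"
    using M by (intro eq_matI) (auto simp: binary_mat_iff perm_mat_def)
  ultimately show thesis
    by (rule that)
qed

text \<open>Concluding from a zero sum of nonnegative terms that each term is zero requires a finite
  index set.\<close>

lemma finite_index_quadruples:
  "finite {(i, j, i', j'). i < (k::nat) \<and> j < (l::nat) \<and> i' < k \<and> j' < l \<and> Q i j i' j'}"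
  by (rule finite_subset[of _ "{..<k} \<times> {..<l} \<times> {..<k} \<times> {..<l}"]) auto

lemma H_A_nonneg:
  assumes "binary_mat (dim_col A) P" and "binary_mat (dim_row A) S"
  shows "H_A A P S \<ge> 0"
  unfolding H_A_def
proof (rule sum_nonneg, clarify)
  fix i j i' j'
  assume "i < dim_row A" "j < dim_col A" "i' < dim_row A" "j' < dim_col A"
  then have "S $$ (i, i') \<in> {0, 1}" "P $$ (j, j') \<in> {0, 1}"
    using assms by (auto simp: binary_mat_iff)
  then show "0 \<le> S $$ (i, i') * P $$ (j, j')"
    by auto
qed

text \<open>The product of entries is 1 at the quadruples \<open>(i, j, \<sigma> i, \<pi> j)\<close>
  and 0 elsewhere, and such a quadruple is summed over exactly when the two entries of
  \<open>A\<close> differ.\<close>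

lemma H_A_perm_mat_eq_0_iff:
  assumes \<pi>: "\<pi> permutes {..<dim_col A}" and \<sigma>: "\<sigma> permutes {..<dim_row A}"
  shows "H_A A (perm_mat (dim_col A) \<pi>) (perm_mat (dim_row A) \<sigma>) = 0 \<longleftrightarrow>
    (\<forall>i<dim_row A. \<forall>j<dim_col A. A $$ (\<sigma> i, \<pi> j) = A $$ (i, j))"
proof -
  have lt: "\<pi> j < dim_col A \<longleftrightarrow> j < dim_col A" "\<sigma> i < dim_row A \<longleftrightarrow> i < dim_row A" for i j
    using permutes_in_image[OF \<pi>] permutes_in_image[OF \<sigma>] by simp_all
  show ?thesis
    unfolding H_A_def
    by (subst sum_nonneg_eq_0_iff[OF finite_index_quadruples])
      (clarsimp, simp add: split_paired_all imp_conjL, metis lt)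
qed

text \<open>Binary entries keep \<open>H_A\<close> nonnegative, so the three summands cannot
  cancel.\<close>

lemma H_Reduced_eq_0_iff:
  assumes "binary_mat (dim_col A) P" and "binary_mat (dim_row A) S"
  shows "H_Reduced A P S = 0 \<longleftrightarrow>
    H_B (dim_col A) P = 0 \<and> H_B (dim_row A) S = 0 \<and> H_A A P S = 0"
  using H_A_nonneg[OF assms] H_B_nonneg[of "dim_col A" P] H_B_nonneg[of "dim_row A" S]
  by (auto simp: H_Reduced_def)

text \<open>This links the setwise condition on the integer variables to the pointwise test in
  \<open>reasonable_vars\<close>. In the backward direction an inclusion suffices, since an
  injective self-map of a finite set is onto.\<close>

lemma permutes_image_lessThan_iff:
  fixes n p :: nat
  assumes \<pi>: "\<pi> permutes {..<n}" and "p \<le> n"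
  shows "\<pi> ` {..<p} = {..<p} \<longleftrightarrow> (\<forall>j<n. j < p \<longleftrightarrow> \<pi> j < p)"
proof
  assume im: "\<pi> ` {..<p} = {..<p}"
  show "\<forall>j<n. j < p \<longleftrightarrow> \<pi> j < p"
    using inj_image_mem_iff[OF permutes_inj[OF \<pi>], of _ "{..<p}"] im by simp
next
  assume "\<forall>j<n. j < p \<longleftrightarrow> \<pi> j < p"
  then have "\<pi> ` {..<p} \<subseteq> {..<p}"
    using \<open>p \<le> n\<close> by (auto dest: less_le_trans)
  then show "\<pi> ` {..<p} = {..<p}"
    using permutes_inj_on[OF \<pi>] by (simp add: endo_inj_surj)
qed

text \<open>The nonzero entries of \<open>perm_mat n \<pi>\<close> sit at
  \<open>(j, \<pi> j)\<close>, so the fixed zeros say that each \<open>\<pi> j\<close> is a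
  reasonable image of \<open>j\<close>; likewise for \<open>\<sigma>\<close>.\<close>

lemma reduced_assignment_perm_mat_iff:
  assumes "A \<in> carrier_mat m n" and "b \<in> carrier_vec m" and "c \<in> carrier_vec n" and "p \<le> n"
    and \<pi>: "\<pi> permutes {..<n}" and \<sigma>: "\<sigma> permutes {..<m}"
  shows "reduced_assignment A b c p (perm_mat n \<pi>) (perm_mat m \<sigma>) \<longleftrightarrow>
    \<pi> ` {..<p} = {..<p} \<and> (\<forall>j<n. c $ \<pi> j = c $ j) \<and> (\<forall>i<m. b $ \<sigma> i = b $ i)"
proof -
  have lt: "\<pi> j < n \<longleftrightarrow> j < n" "\<sigma> i < m \<longleftrightarrow> i < m" for i j
    using permutes_in_image[OF \<pi>] permutes_in_image[OF \<sigma>] by simp_all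
  have "reduced_assignment A b c p (perm_mat n \<pi>) (perm_mat m \<sigma>) \<longleftrightarrow>
    (\<forall>j<n. \<pi> j \<in> reasonable_vars p c j) \<and> (\<forall>i<m. \<sigma> i \<in> reasonable_cons b i)"
    using assms(1) lt by (auto simp: reduced_assignment_def binary_perm_mat)
  also have "\<dots> \<longleftrightarrow>
    (\<forall>j<n. j < p \<longleftrightarrow> \<pi> j < p) \<and> (\<forall>j<n. c $ \<pi> j = c $ j) \<and> (\<forall>i<m. b $ \<sigma> i = b $ i)"
    \<comment> \<open>The range conditions on images reduce to those on indices by
      \<open>lt\<close>; \<open>eq_commute\<close> aligns the orientation of the equations for
      \<open>b\<close> and \<open>c\<close>.\<close>
    unfolding reasonable_vars_def reasonable_cons_def mem_Collect_eq
      carrier_vecD[OF assms(2)] carrier_vecD[OF assms(3)] lt eq_commute[of "c $ \<pi> j" for j]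
      eq_commute[of "b $ \<sigma> i" for i]
    by blast
  finally show ?thesis
    using permutes_image_lessThan_iff[OF \<pi> \<open>p \<le> n\<close>] by simp
qed

theorem corollary1:
  fixes A :: "real mat" and b c :: "real vec" and m n p :: nat
  assumes "A \<in> carrier_mat m n" and "b \<in> carrier_vec m" and "c \<in> carrier_vec n" and "p \<le> n"
  shows "(\<forall>P S. reduced_assignment A b c p P S \<and> H_Reduced A P S = 0
            \<longrightarrow> formulation_symmetry_mat A b c p P) \<and>
         (\<forall>\<pi>. formulation_symmetry A b c p \<pi> \<longrightarrow>
            (\<exists>\<sigma>. corresponding_constraint_perm A b \<pi> \<sigma> \<and>
                 reduced_assignment A b c p (perm_mat n \<pi>) (perm_mat m \<sigma>) \<and>
                 H_Reduced A (perm_mat n \<pi>) (perm_mat m \<sigma>) = 0))"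
proof (intro conjI allI impI; (elim conjE)?)
  have dim [simp]: "dim_row A = m" "dim_col A = n"
    using assms(1) by auto
  {
    fix P S
    assume red: "reduced_assignment A b c p P S" and H: "H_Reduced A P S = 0"
    have bin: "binary_mat n P" "binary_mat m S"
      using red by (simp_all add: reduced_assignment_def)
    have H0: "H_B n P = 0" "H_B m S = 0" "H_A A P S = 0"
      using H H_Reduced_eq_0_iff[of A P S] bin by simp_all
    obtain \<pi> where \<pi>: "\<pi> permutes {..<n}" "P = perm_mat n \<pi>"
      using binary_mat_H_B_eq_0D[OF bin(1) H0(1)] .
    obtain \<sigma> where \<sigma>: "\<sigma> permutes {..<m}" "S = perm_mat m \<sigma>"
      using binary_mat_H_B_eq_0D[OF bin(2) H0(2)] .
    \<comment> \<open>The permutation \<open>\<sigma>\<close> read off from \<open>S\<close> is the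
      required constraint permutation: the fixed zeros give the conditions on \<open>b\<close>,
      \<open>c\<close> and \<open>p\<close>, and \<open>H_A\<close> gives the one on
      \<open>A\<close>.\<close>
    have "formulation_symmetry A b c p \<pi>"
      using red reduced_assignment_perm_mat_iff[OF assms \<pi>(1) \<sigma>(1)]
        H0(3) H_A_perm_mat_eq_0_iff[of \<pi> A \<sigma>] \<pi> \<sigma>
      by (auto simp: formulation_symmetry_def corresponding_constraint_perm_def)
    then show "formulation_symmetry_mat A b c p P"
      using \<pi>(2) by (auto simp: formulation_symmetry_mat_def)
  }
  {
    fix \<pi>
    assume sym: "formulation_symmetry A b c p \<pi>"
    then obtain \<sigma> where \<sigma>: "corresponding_constraint_perm A b \<pi> \<sigma>"
      by (auto simp: formulation_symmetry_def)
    have perm: "\<pi> permutes {..<n}" "\<sigma> permutes {..<m}"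
      using sym \<sigma> by (simp_all add: formulation_symmetry_def corresponding_constraint_perm_def)
    \<comment> \<open>The same equivalences, read in the other direction, show that any constraint
      permutation corresponding to \<open>\<pi>\<close> serves as the witness.\<close>
    have "reduced_assignment A b c p (perm_mat n \<pi>) (perm_mat m \<sigma>)"
      using sym \<sigma> reduced_assignment_perm_mat_iff[OF assms perm]
      by (simp add: formulation_symmetry_def corresponding_constraint_perm_def)
    moreover have "H_Reduced A (perm_mat n \<pi>) (perm_mat m \<sigma>) = 0"
      using \<sigma> perm H_A_perm_mat_eq_0_iff[of \<pi> A \<sigma>]
      by (simp add: H_Reduced_def H_B_perm_mat corresponding_constraint_perm_def)
    ultimately show "\<exists>\<sigma>. corresponding_constraint_perm A b \<pi> \<sigma> \<and>
        reduced_assignment A b c p (perm_mat n \<pi>) (perm_mat m \<sigma>) \<and>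
        H_Reduced A (perm_mat n \<pi>) (perm_mat m \<sigma>) = 0"
      using \<sigma> by blast
  }
qed

end
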